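(* Let $c>1$ and $k_2\in(0,1/2)$ be fixed constants, and let every group consist of a single coefficient ($p_j=1$ for $j\in[p]$), so that $\mathcal{S}=\{j\in[p]:\beta^\star_j\ne0\}$. Suppose that each column $X_{\cdot,j}$ of $X$ satisfies $\|X_{\cdot,j}\|_2\le\sqrt n$, that $$\lambda=\frac{c\sigma}{\underline\nu}\sqrt{\frac{2\log(p/k_2)}{n}},$$ and that the following assumptions hold. A1 (Subgaussian errors). $y=X\beta^\star+\epsilon$, where $\epsilon\in\mathbb{R}^n$ has independent entries, each $\sigma$-subgaussian with $0<\sigma<\infty$: $\mathbb{E}(\epsilon_i)=0$ and $\mathbb{E}\{\exp(t\epsilon_i)\}\le\exp(t^2\sigma^2/2)$ for all $t\in\mathbb{R}$ and $i\in[n]$. A2 (Convexity). $X^{\mathsf T}X\succeq\lambda B^{\mathsf T}B$. A3 (Sample size). $n$ is sufficiently large that $\nu_k>0$ for all $k\in\mathcal{S}^c$. A4 (Restricted eigenvalue condition). There is a constant $k>0$ (the same for all $n$ and $p$) such that $0<k\le\kappa_B(\mathcal{S},c)$. Then, with probability at least $1-2k_2$, $$\|\hat\beta(\lambda)-\beta^\star\|_2\le\frac{c\sigma}{\kappa_B(\mathcal{S},c)}\left(\frac{\bar\nu}{\underline\nu}+\frac1c\right)\sqrt{\frac{2|\mathcal{S}|\log(p/k_2)}{n}},$$ where $\hat\beta(\lambda)$ is the corresponding GMC estimator.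
   Context: Write $[m]=\{1,\dots,m\}$. $X\in\mathbb{R}^{n\times p}$ is a fixed design matrix, $\beta^\star\in\mathbb{R}^p$ is the true coefficient vector, and $B$ is a real matrix with $p$ columns. $K_1,\dots,K_p$ are nonnegative weights. $M\succeq N$ means $M-N$ is positive semidefinite. GMC (generalized minimax concave) penalty, i.e. the group GMC penalty with singleton groups: $\Phi_B(\beta)=\sum_{j=1}^p K_j|\beta_j|-\min_{v\in\mathbb{R}^p}\left\{\sum_{j=1}^p K_j|v_j|+\frac{1}{2n}\|B(\beta-v)\|_2^2\right\}$. The GMC estimator $\hat\beta(\lambda)$ is a minimizer over $\beta\in\mathbb{R}^p$ of $\frac{1}{2n}\|y-X\beta\|_2^2+\lambda\Phi_B(\beta)$. Let $v^\star\in\arg\min_{v\in\mathbb{R}^p}\left\{\sum_{j=1}^p K_j|v_j|+\frac{1}{2n}\|B(\beta^\star-v)\|_2^2\right\}$ and $\mathcal{S}^c=[p]\setminus\mathcal{S}$. With $[B^{\mathsf T}B]_{j,\cdot}$ the $j$-th row of $B^{\mathsf T}B$, define $$\nu_j=\begin{cases}K_j+n^{-1}\left|[B^{\mathsf T}B]_{j,\cdot}(\beta^\star-v^\star)\right|,& j\in\mathcal{S},\\ K_j-n^{-1}\left|[B^{\mathsf T}B]_{j,\cdot}(\beta^\star-v^\star)\right|,& j\in\mathcal{S}^c,\end{cases}$$ and $\bar\nu=\max_{j\in\mathcal{S}}\nu_j$, $\underline\nu=\min_{k\in\mathcal{S}^c}\nu_k$ (so $\mathcal{S}$ and $\mathcal{S}^c$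 are implicitly nonempty). Define $$\mathbb{C}_n(\mathcal{S},\nu,c)=\left\{\Delta\in\mathbb{R}^p:\Delta\ne0,\ \sum_{k\in\mathcal{S}^c}\left(\nu_k-\frac{\underline\nu}{c}\right)|\Delta_k|\le\sum_{j\in\mathcal{S}}\left(\nu_j+\frac{\underline\nu}{c}\right)|\Delta_j|\right\}$$ and $$\kappa_B(\mathcal{S},c)=\inf_{\Delta\in\mathbb{C}_n(\mathcal{S},\nu,c)}\frac{\Delta^{\mathsf T}(X^{\mathsf T}X-\lambda B^{\mathsf T}B)\Delta}{2n\|\Delta\|_2^2}.$$ *)

theory Defs
  imports "HOL-Analysis.Analysis" "HOL-Probability.Probability"
begin

text \<open>
  The sample size \<open>n\<close> and the number of coefficients \<open>p\<close> are the cardinalities of the finite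
  index types \<open>'n\<close> and \<open>'p\<close>, and \<open>B\<close> may have any number of rows (index type \<open>'m\<close>).
  Since \<open>n\<close> cannot be read off from \<open>B\<close>, definitions that do not involve \<open>X\<close> take it
  as an explicit argument.
\<close>

definition psd :: "real^'p^'p \<Rightarrow> bool" where
  "psd A \<longleftrightarrow> transpose A = A \<and> (\<forall>x. 0 \<le> x \<bullet> (A *v x))"

definition weighted_l1 :: "real^'p \<Rightarrow> real^'p \<Rightarrow> real" where
  "weighted_l1 K \<beta> = (\<Sum>j\<in>UNIV. K $ j * \<bar>\<beta> $ j\<bar>)"

definition gmc_inner :: "nat \<Rightarrow> real^'p^'m \<Rightarrow> real^'p \<Rightarrow> real^'p \<Rightarrow> real^'p \<Rightarrow> real" where
  "gmc_inner n B K \<beta> v = weighted_l1 K v + 1 / (2 * real n) * (norm (B *v (\<beta> - v)))\<^sup>2"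

text \<open>
  The infimum below is a minimum for nonnegative weights: the objective is then a convex,
  piecewise quadratic function of \<open>v\<close> that is bounded below by \<open>0\<close>.
\<close>

definition gmc_penalty :: "nat \<Rightarrow> real^'p^'m \<Rightarrow> real^'p \<Rightarrow> real^'p \<Rightarrow> real" where
  "gmc_penalty n B K \<beta> = weighted_l1 K \<beta> - (INF v. gmc_inner n B K \<beta> v)"

definition gmc_objective ::
    "real^'p^'n \<Rightarrow> real^'p^'m \<Rightarrow> real^'p \<Rightarrow> real \<Rightarrow> real^'n \<Rightarrow> real^'p \<Rightarrow> real" where
  "gmc_objective X B K lam y \<beta> =
     1 / (2 * real CARD('n)) * (norm (y - X *v \<beta>))\<^sup>2 + lam * gmc_penalty CARD('n) B K \<beta>"

definition is_gmc_estimator ::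
    "real^'p^'n \<Rightarrow> real^'p^'m \<Rightarrow> real^'p \<Rightarrow> real \<Rightarrow> real^'n \<Rightarrow> real^'p \<Rightarrow> bool" where
  "is_gmc_estimator X B K lam y b \<longleftrightarrow> is_arg_min (gmc_objective X B K lam y) (\<lambda>_. True) b"

definition gmc_nu ::
    "nat \<Rightarrow> real^'p^'m \<Rightarrow> real^'p \<Rightarrow> real^'p \<Rightarrow> real^'p \<Rightarrow> 'p set \<Rightarrow> 'p \<Rightarrow> real" where
  "gmc_nu n B K \<beta> v S j =
     (if j \<in> S
      then K $ j + 1 / real n * \<bar>row j (transpose B ** B) \<bullet> (\<beta> - v)\<bar>
      else K $ j - 1 / real n * \<bar>row j (transpose B ** B) \<bullet> (\<beta> - v)\<bar>)"

definition nu_max :: "'p::finite set \<Rightarrow> ('p \<Rightarrow> real) \<Rightarrow> real" where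
  "nu_max S \<nu> = Max (\<nu> ` S)"

definition nu_min :: "'p::finite set \<Rightarrow> ('p \<Rightarrow> real) \<Rightarrow> real" where
  "nu_min S \<nu> = Min (\<nu> ` (- S))"

definition gmc_cone :: "'p set \<Rightarrow> ('p \<Rightarrow> real) \<Rightarrow> real \<Rightarrow> (real^'p) set" where
  "gmc_cone S \<nu> c = {\<Delta>. \<Delta> \<noteq> 0 \<and>
     (\<Sum>k\<in>- S. (\<nu> k - nu_min S \<nu> / c) * \<bar>\<Delta> $ k\<bar>)
       \<le> (\<Sum>j\<in>S. (\<nu> j + nu_min S \<nu> / c) * \<bar>\<Delta> $ j\<bar>)}"

definition gmc_kappa ::
    "real^'p^'n \<Rightarrow> real^'p^'m \<Rightarrow> real \<Rightarrow> 'p set \<Rightarrow> ('p \<Rightarrow> real) \<Rightarrow> real \<Rightarrow> real" where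
  "gmc_kappa X B lam S \<nu> c =
     (INF \<Delta> \<in> gmc_cone S \<nu> c.
        (\<Delta> \<bullet> ((transpose X ** X - lam *\<^sub>R (transpose B ** B)) *v \<Delta>))
          / (2 * real CARD('n) * (norm \<Delta>)\<^sup>2))"

text \<open>
  Integrability of the exponentials is stated explicitly because the Bochner integral of a
  non-integrable function is \<open>0\<close>; it implies that \<open>Z\<close> itself is integrable.
\<close>

definition subgaussian :: "'a measure \<Rightarrow> real \<Rightarrow> ('a \<Rightarrow> real) \<Rightarrow> bool" where
  "subgaussian M \<sigma> Z \<longleftrightarrow>
     Z \<in> borel_measurable M \<and> (\<integral>\<omega>. Z \<omega> \<partial>M) = 0 \<and>
     (\<forall>t::real. integrable M (\<lambda>\<omega>. exp (t * Z \<omega>)) \<and>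
        (\<integral>\<omega>. exp (t * Z \<omega>) \<partial>M) \<le> exp (t\<^sup>2 * \<sigma>\<^sup>2 / 2))"

end

theory Submission
  imports Defs
begin

text \<open>
  Comparing the objective at the estimator and at the truth, and inserting the minimiser \<open>v\<close> for
  \<open>\<beta>\<close> as a competitor in the inner problem at the estimator, the concave part of the penalty
  costs only the linear term \<open>B\<^sup>T B (\<beta> - v)\<close>, which turns the weights \<open>K\<close> into \<open>\<nu>\<close>, and the
  quadratic term that is subtracted from \<open>X\<^sup>T X\<close>.  On the event that every \<open>\<bar>X\<^sub>j \<bullet> \<epsilon>\<bar> / n\<close> is at
  most \<open>\<lambda> \<nu>\<^sub>m\<^sub>i\<^sub>n / c\<close>, convexity forces the error into the cone, and the restricted eigenvalue
  converts the remaining linear bound into a bound on its norm.  A Chernoff bound gives the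
  probability of that event.
\<close>

section \<open>Linear algebra and coordinate inequalities\<close>

lemma inner_transpose_mult_self:
  fixes A :: "real^'p^'m"
  shows "x \<bullet> ((transpose A ** A) *v z) = (A *v x) \<bullet> (A *v z)"
  by (metis dot_lmul_matrix matrix_vector_mul_assoc vector_transpose_matrix transpose_transpose)

lemma inner_le_sum_abs:
  fixes a x :: "real^'p"
  shows "a \<bullet> x \<le> (\<Sum>j\<in>UNIV. \<bar>a $ j\<bar> * \<bar>x $ j\<bar>)"
  by (auto simp: inner_vec_def intro!: sum_mono) (metis abs_ge_self abs_mult)

text \<open>Cauchy-Schwarz against the constant 1 on \<open>S\<close>; this is the source of the
  square root of |S| in the final bound.\<close>

lemma sum_abs_le_sqrt_card_norm:
  fixes x :: "real^'p"
  shows "(\<Sum>j\<in>S. \<bar>x $ j\<bar>) \<le> sqrt (real (card S)) * norm x"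
proof -
  have "(\<Sum>j\<in>S. \<bar>x $ j\<bar>) \<le> L2_set (\<lambda>_. 1) S * L2_set (\<lambda>j. x $ j) S"
    using L2_set_mult_ineq[of "\<lambda>_. 1" "\<lambda>j. x $ j" S] by simp
  also have "L2_set (\<lambda>_. 1) S = sqrt (real (card S))"
    by (simp add: L2_set_def)
  also have "L2_set (\<lambda>j. x $ j) S \<le> norm x"
    unfolding norm_vec_def L2_set_def by (auto intro!: real_sqrt_le_mono sum_mono2)
  finally show ?thesis
    by (simp add: mult_left_mono)
qed

section \<open>Concentration of linear forms in subgaussian noise\<close>

lemma (in prob_space) subgaussian_inner_mgf:
  fixes Z :: "'a \<Rightarrow> real^'n" and a :: "real^'n"
  assumes indep: "indep_vars (\<lambda>_. borel) (\<lambda>i \<omega>. Z \<omega> $ i) UNIV"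
    and sub: "\<And>i. subgaussian M \<sigma> (\<lambda>\<omega>. Z \<omega> $ i)"
  shows "integrable M (\<lambda>\<omega>. exp (a \<bullet> Z \<omega>))" (is ?int)
    and "expectation (\<lambda>\<omega>. exp (a \<bullet> Z \<omega>)) \<le> exp ((norm a)\<^sup>2 * \<sigma>\<^sup>2 / 2)" (is ?le)
proof -
  \<comment> \<open>Independence lets the expectation pass through this product, so the variance
    proxies of the summands add up to \<open>\<sigma>\<close> squared times the squared norm of
    \<open>a\<close>.\<close>
  have eq: "exp (a \<bullet> Z \<omega>) = (\<Prod>i\<in>UNIV. exp (a $ i * Z \<omega> $ i))" for \<omega>
    by (simp add: inner_vec_def exp_sum)
  have indep_exp: "indep_vars (\<lambda>_. borel) (\<lambda>i \<omega>. exp (a $ i * Z \<omega> $ i)) UNIV"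
    using indep_vars_compose2[OF indep, of "\<lambda>i x. exp (a $ i * x)" "\<lambda>_. borel"] by simp
  have int: "integrable M (\<lambda>\<omega>. exp (a $ i * Z \<omega> $ i))"
    and le: "expectation (\<lambda>\<omega>. exp (a $ i * Z \<omega> $ i)) \<le> exp ((a $ i)\<^sup>2 * \<sigma>\<^sup>2 / 2)" for i
    using sub[of i] by (auto simp: subgaussian_def)
  show ?int
    unfolding eq by (rule indep_vars_integrable[OF finite indep_exp int])
  have "expectation (\<lambda>\<omega>. exp (a \<bullet> Z \<omega>)) = (\<Prod>i\<in>UNIV. expectation (\<lambda>\<omega>. exp (a $ i * Z \<omega> $ i)))"
    unfolding eq by (rule indep_vars_lebesgue_integral[OF finite indep_exp int])
  also have "\<dots> \<le> (\<Prod>i\<in>UNIV. exp ((a $ i)\<^sup>2 * \<sigma>\<^sup>2 / 2))"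
    by (intro prod_mono conjI le integral_nonneg_AE) auto
  also have "\<dots> = exp ((norm a)\<^sup>2 * \<sigma>\<^sup>2 / 2)"
    unfolding power2_norm_eq_inner
    by (simp add: exp_sum[symmetric] inner_vec_def power2_eq_square sum_distrib_right sum_divide_distrib)
  finally show ?le .
qed

text \<open>Chernoff's method. Bounding the norm of \<open>a\<close> by \<open>r\<close> gives one
  exponent that serves all columns of the design at once.\<close>

lemma (in prob_space) subgaussian_inner_tail:
  fixes Z :: "'a \<Rightarrow> real^'n" and a :: "real^'n"
  assumes indep: "indep_vars (\<lambda>_. borel) (\<lambda>i \<omega>. Z \<omega> $ i) UNIV"
    and sub: "\<And>i. subgaussian M \<sigma> (\<lambda>\<omega>. Z \<omega> $ i)"
    and "0 < \<sigma>" "0 < r" "norm a \<le> r" "0 < t"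
  shows "prob {\<omega>\<in>space M. t \<le> a \<bullet> Z \<omega>} \<le> exp (- (t\<^sup>2 / (2 * \<sigma>\<^sup>2 * r\<^sup>2)))"
proof -
  \<comment> \<open>This \<open>s\<close> minimises the exponent
    \<open>(s * r)^2 * \<sigma>^2 / 2 - s * t\<close> left after Markov's inequality.\<close>
  define s where "s = t / (\<sigma>\<^sup>2 * r\<^sup>2)"
  have s: "0 < s"
    using assms by (simp add: s_def)
  have "{\<omega>\<in>space M. t \<le> a \<bullet> Z \<omega>} = {\<omega>\<in>space M. exp (s * t) \<le> exp ((s *\<^sub>R a) \<bullet> Z \<omega>)}"
    using s by simp
  also have "prob \<dots> \<le> expectation (\<lambda>\<omega>. exp ((s *\<^sub>R a) \<bullet> Z \<omega>)) / exp (s * t)"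
    by (rule integral_Markov_inequality_measure[where A = "{}"])
      (use subgaussian_inner_mgf(1)[OF indep sub, of "s *\<^sub>R a"] in auto)
  also have "\<dots> \<le> exp ((norm (s *\<^sub>R a))\<^sup>2 * \<sigma>\<^sup>2 / 2) / exp (s * t)"
    by (intro divide_right_mono subgaussian_inner_mgf(2)[OF indep sub]) simp
  also have "\<dots> \<le> exp ((s * r)\<^sup>2 * \<sigma>\<^sup>2 / 2) / exp (s * t)"
    using s \<open>norm a \<le> r\<close> by (auto intro!: divide_right_mono mult_right_mono power_mono mult_left_mono)
  also have "\<dots> = exp ((s * r)\<^sup>2 * \<sigma>\<^sup>2 / 2 - s * t)"
    by (simp add: exp_diff)
  also have "(s * r)\<^sup>2 * \<sigma>\<^sup>2 / 2 - s * t = - (t\<^sup>2 / (2 * \<sigma>\<^sup>2 * r\<^sup>2))"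
    using \<open>0 < \<sigma>\<close> \<open>0 < r\<close> by (simp add: s_def field_simps power2_eq_square)
  finally show ?thesis .
qed

lemma (in prob_space) subgaussian_columns_bound:
  fixes Z :: "'a \<Rightarrow> real^'n" and X :: "real^'p^'n"
  assumes indep: "indep_vars (\<lambda>_. borel) (\<lambda>i \<omega>. Z \<omega> $ i) UNIV"
    and sub: "\<And>i. subgaussian M \<sigma> (\<lambda>\<omega>. Z \<omega> $ i)"
    and pos: "0 < \<sigma>" "0 < r" "0 < t" and col: "\<And>j. norm (column j X) \<le> r"
  shows "{\<omega>\<in>space M. \<forall>j. \<bar>column j X \<bullet> Z \<omega>\<bar> \<le> t} \<in> events"
    and "1 - 2 * real CARD('p) * exp (- (t\<^sup>2 / (2 * \<sigma>\<^sup>2 * r\<^sup>2)))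
      \<le> prob {\<omega>\<in>space M. \<forall>j. \<bar>column j X \<bullet> Z \<omega>\<bar> \<le> t}" (is "_ \<le> prob ?E")
proof -
  let ?A = "\<lambda>a. {\<omega>\<in>space M. t \<le> a \<bullet> Z \<omega>}" and ?q = "exp (- (t\<^sup>2 / (2 * \<sigma>\<^sup>2 * r\<^sup>2)))"
  have [measurable]: "(\<lambda>\<omega>. Z \<omega> $ i) \<in> borel_measurable M" for i
    using sub[of i] by (simp add: subgaussian_def)
  have [measurable]: "(\<lambda>\<omega>. a \<bullet> Z \<omega>) \<in> borel_measurable M" for a
    unfolding inner_vec_def by measurable
  show meas: "?E \<in> events"
    by measurable
  \<comment> \<open>Union bound over 2p one-sided tails, a column and its negative for each
    coefficient. Outside \<open>?E\<close> some absolute value exceeds \<open>t\<close> strictly, so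
    inclusion in the non-strict tails suffices.\<close>
  have "prob (space M - ?E) \<le> prob (\<Union>j\<in>UNIV. ?A (column j X) \<union> ?A (- column j X))"
    by (rule finite_measure_mono) (auto simp: abs_le_iff not_le intro: less_imp_le)
  also have "\<dots> \<le> (\<Sum>j\<in>UNIV. prob (?A (column j X) \<union> ?A (- column j X)))"
    by (rule finite_measure_subadditive_finite) auto
  also have "\<dots> \<le> (\<Sum>j\<in>(UNIV::'p set). ?q + ?q)"
  proof (rule sum_mono)
    fix j
    have "prob (?A (column j X) \<union> ?A (- column j X)) \<le> prob (?A (column j X)) + prob (?A (- column j X))"
      by (rule measure_Un_le) auto
    also have "\<dots> \<le> ?q + ?q"
      using col by (intro add_mono subgaussian_inner_tail[OF indep sub pos(1,2) _ pos(3)]) simp_all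
    finally show "prob (?A (column j X) \<union> ?A (- column j X)) \<le> ?q + ?q" .
  qed
  finally have "prob (space M - ?E) \<le> 2 * real CARD('p) * ?q"
    by simp
  then show "1 - 2 * real CARD('p) * ?q \<le> prob ?E"
    using prob_compl[OF meas] by simp
qed

section \<open>The deterministic error bound\<close>

lemma gmc_inner_nonneg:
  assumes "\<And>j. 0 \<le> K $ j"
  shows "0 \<le> gmc_inner n B K \<beta> v"
  using assms by (auto simp: gmc_inner_def weighted_l1_def intro!: add_nonneg_nonneg sum_nonneg)

text \<open>The vector \<open>v\<close> is optimal in the inner problem at \<open>\<beta>\<close>
  but only a competitor at \<open>b\<close>. Hence the inner minimum grows from
  \<open>\<beta>\<close> to \<open>b\<close> by at most the change of the inner objective at fixed
  \<open>v\<close>, where the l1 term cancels and an explicit quadratic in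
  \<open>b - \<beta>\<close> remains.\<close>

lemma gmc_penalty_diff_ge:
  fixes B :: "real^'p^'m"
  assumes K: "\<And>j. 0 \<le> K $ j" and v: "is_arg_min (gmc_inner n B K \<beta>) (\<lambda>_. True) v"
  shows "weighted_l1 K b - weighted_l1 K \<beta> - (b - \<beta>) \<bullet> ((transpose B ** B) *v (\<beta> - v)) / real n
      - (norm (B *v (b - \<beta>)))\<^sup>2 / (2 * real n)
    \<le> gmc_penalty n B K b - gmc_penalty n B K \<beta>"
proof -
  have "(INF w. gmc_inner n B K b w) \<le> gmc_inner n B K b v"
    by (rule cINF_lower) (auto intro: bdd_belowI[where m = 0] gmc_inner_nonneg[OF K])
  moreover have "gmc_inner n B K \<beta> v \<le> (INF w. gmc_inner n B K \<beta> w)"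
    using v by (intro cINF_greatest) (auto simp: is_arg_min_linorder)
  moreover have "B *v (b - v) = B *v (b - \<beta>) + B *v (\<beta> - v)"
    by (simp flip: matrix_vector_right_distrib)
  then have "(norm (B *v (b - v)))\<^sup>2 = (norm (B *v (b - \<beta>)))\<^sup>2 + (norm (B *v (\<beta> - v)))\<^sup>2
      + 2 * ((b - \<beta>) \<bullet> ((transpose B ** B) *v (\<beta> - v)))"
    by (simp add: inner_transpose_mult_self power2_norm_eq_inner inner_add_left inner_add_right
        inner_commute)
  then have "gmc_inner n B K b v - gmc_inner n B K \<beta> v
      = (b - \<beta>) \<bullet> ((transpose B ** B) *v (\<beta> - v)) / real n + (norm (B *v (b - \<beta>)))\<^sup>2 / (2 * real n)"
    by (simp add: gmc_inner_def add_divide_distrib)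
  ultimately show ?thesis
    by (simp add: gmc_penalty_def)
qed

text \<open>The triangle inequality on the support of \<open>\<beta>\<close>; off the support
  \<open>\<beta>\<close> vanishes and the two sides agree, which produces the negative
  weights.\<close>

lemma weighted_l1_diff_le:
  fixes \<beta> b :: "real^'p"
  assumes K: "\<And>j. 0 \<le> K $ j"
  shows "weighted_l1 K \<beta> - weighted_l1 K b
    \<le> (\<Sum>j\<in>UNIV. (if \<beta> $ j \<noteq> 0 then K $ j else - K $ j) * \<bar>(b - \<beta>) $ j\<bar>)"
  unfolding weighted_l1_def sum_subtractf[symmetric]
proof (rule sum_mono)
  fix j
  have "K $ j * (\<bar>\<beta> $ j\<bar> - \<bar>b $ j\<bar>) \<le> K $ j * \<bar>(b - \<beta>) $ j\<bar>"
    using K by (intro mult_left_mono) auto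
  then show "K $ j * \<bar>\<beta> $ j\<bar> - K $ j * \<bar>b $ j\<bar>
      \<le> (if \<beta> $ j \<noteq> 0 then K $ j else - K $ j) * \<bar>(b - \<beta>) $ j\<bar>"
    by (simp add: algebra_simps)
qed

text \<open>The noise is a fixed vector \<open>e\<close> here, with randomness confined to the
  hypothesis \<open>noise\<close>. The level \<open>\<mu>\<close> is later set to
  \<open>nu_min S \<nu> / c\<close>, which turns the right-hand side into the slack in the cone
  condition.\<close>

lemma gmc_basic_inequality:
  fixes X :: "real^'p^'n" and B :: "real^'p^'m" and e :: "real^'n" and \<beta> b :: "real^'p"
  assumes K: "\<And>j. 0 \<le> K $ j" and lam: "0 \<le> lam"
    and v: "is_arg_min (gmc_inner CARD('n) B K \<beta>) (\<lambda>_. True) v"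
    and est: "is_gmc_estimator X B K lam (X *v \<beta> + e) b"
    and \<nu>: "\<nu> = gmc_nu CARD('n) B K \<beta> v {j. \<beta> $ j \<noteq> 0}"
    and noise: "\<And>j. \<bar>column j X \<bullet> e\<bar> \<le> real CARD('n) * (lam * \<mu>)"
  defines "S \<equiv> {j. \<beta> $ j \<noteq> 0}" and "\<Delta> \<equiv> b - \<beta>"
  shows "\<Delta> \<bullet> ((transpose X ** X - lam *\<^sub>R (transpose B ** B)) *v \<Delta>) / (2 * real CARD('n))
    \<le> lam * ((\<Sum>j\<in>S. (\<nu> j + \<mu>) * \<bar>\<Delta> $ j\<bar>) - (\<Sum>j\<in>-S. (\<nu> j - \<mu>) * \<bar>\<Delta> $ j\<bar>))"
proof -
  let ?n = "real CARD('n)" and ?g = "(transpose B ** B) *v (\<beta> - v)"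
  let ?K = "\<lambda>j. if j \<in> S then K $ j else - K $ j"
  have n: "0 < ?n" by simp
  have quad: "\<Delta> \<bullet> ((transpose X ** X - lam *\<^sub>R (transpose B ** B)) *v \<Delta>)
      = (norm (X *v \<Delta>))\<^sup>2 - lam * (norm (B *v \<Delta>))\<^sup>2"
    by (simp add: matrix_vector_mult_diff_rdistrib inner_diff_right scaleR_matrix_vector_assoc[symmetric]
        inner_transpose_mult_self power2_norm_eq_inner)
  have "X *v \<beta> + e - X *v b = e - X *v \<Delta>"
    by (simp add: \<Delta>_def matrix_vector_mult_diff_distrib)
  then have sq: "(norm (X *v \<beta> + e - X *v b))\<^sup>2 = (norm e)\<^sup>2 - 2 * (e \<bullet> (X *v \<Delta>)) + (norm (X *v \<Delta>))\<^sup>2"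
    by (simp only:) (simp add: power2_norm_eq_inner inner_diff_left inner_diff_right inner_commute)
  have "gmc_objective X B K lam (X *v \<beta> + e) b \<le> gmc_objective X B K lam (X *v \<beta> + e) \<beta>"
    using est by (simp add: is_gmc_estimator_def is_arg_min_linorder)
  then have "(norm (X *v \<Delta>))\<^sup>2 / (2 * ?n) \<le> e \<bullet> (X *v \<Delta>) / ?n
      - lam * (gmc_penalty CARD('n) B K b - gmc_penalty CARD('n) B K \<beta>)"
    unfolding gmc_objective_def sq by (simp add: add_divide_distrib diff_divide_distrib right_diff_distrib)
  also have "\<dots> \<le> e \<bullet> (X *v \<Delta>) / ?n - lam * (weighted_l1 K b - weighted_l1 K \<beta>
      - \<Delta> \<bullet> ?g / ?n - (norm (B *v \<Delta>))\<^sup>2 / (2 * ?n))"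
    using gmc_penalty_diff_ge[OF K v, of b] lam by (intro diff_left_mono mult_left_mono) (simp_all add: \<Delta>_def)
  \<comment> \<open>The quadratic loss from the concave part of the penalty moves to the left, where
    it is subtracted from the least-squares term.\<close>
  finally have "((norm (X *v \<Delta>))\<^sup>2 - lam * (norm (B *v \<Delta>))\<^sup>2) / (2 * ?n)
      \<le> e \<bullet> (X *v \<Delta>) / ?n + lam * ((weighted_l1 K \<beta> - weighted_l1 K b) + \<Delta> \<bullet> ?g / ?n)"
    by (simp add: algebra_simps diff_divide_distrib)
  also have "\<dots> \<le> lam * (\<Sum>j\<in>UNIV. \<mu> * \<bar>\<Delta> $ j\<bar>)
      + lam * ((\<Sum>j\<in>UNIV. ?K j * \<bar>\<Delta> $ j\<bar>) + (\<Sum>j\<in>UNIV. 1 / ?n * \<bar>?g $ j\<bar> * \<bar>\<Delta> $ j\<bar>))"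
  proof (intro add_mono mult_left_mono lam)
    \<comment> \<open>The noise acts on the error only through its correlations with the columns, so
      the columnwise bound applies coordinate by coordinate.\<close>
    have "e \<bullet> (X *v \<Delta>) = (\<chi> j. column j X \<bullet> e) \<bullet> \<Delta>"
      by (simp add: dot_lmul_matrix[symmetric])
        (simp add: inner_vec_def vector_matrix_mult_def column_def mult.commute)
    also have "\<dots> \<le> (\<Sum>j\<in>UNIV. \<bar>column j X \<bullet> e\<bar> * \<bar>\<Delta> $ j\<bar>)"
      using inner_le_sum_abs[of "\<chi> j. column j X \<bullet> e"] by simp
    also have "\<dots> \<le> (\<Sum>j\<in>UNIV. ?n * (lam * \<mu>) * \<bar>\<Delta> $ j\<bar>)"
      by (intro sum_mono mult_right_mono noise) simp
    also have "\<dots> = ?n * (lam * (\<Sum>j\<in>UNIV. \<mu> * \<bar>\<Delta> $ j\<bar>))"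
      by (simp add: sum_distrib_left mult.assoc)
    finally show "e \<bullet> (X *v \<Delta>) / ?n \<le> lam * (\<Sum>j\<in>UNIV. \<mu> * \<bar>\<Delta> $ j\<bar>)"
      by (simp add: divide_le_eq mult.commute)
    show "weighted_l1 K \<beta> - weighted_l1 K b \<le> (\<Sum>j\<in>UNIV. ?K j * \<bar>\<Delta> $ j\<bar>)"
      using weighted_l1_diff_le[OF K, of \<beta> b] by (simp add: S_def \<Delta>_def)
    show "\<Delta> \<bullet> ?g / ?n \<le> (\<Sum>j\<in>UNIV. 1 / ?n * \<bar>?g $ j\<bar> * \<bar>\<Delta> $ j\<bar>)"
      using inner_le_sum_abs[of ?g \<Delta>] n
      by (simp add: inner_commute[of \<Delta>] sum_divide_distrib[symmetric] divide_right_mono)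
  qed
  also have "\<dots> = lam * (\<Sum>j\<in>UNIV. (\<mu> + ?K j + 1 / ?n * \<bar>?g $ j\<bar>) * \<bar>\<Delta> $ j\<bar>)"
    by (simp add: distrib_left distrib_right sum.distrib)
  \<comment> \<open>The absolute gradient \<open>?g\<close> is added to \<open>K\<close> on
    \<open>S\<close> and to \<open>- K\<close> off \<open>S\<close>, giving \<open>\<nu>\<close> and
    \<open>- \<nu>\<close> respectively; this explains the two signs in
    \<open>gmc_nu\<close>.\<close>
  also have "(\<Sum>j\<in>UNIV. (\<mu> + ?K j + 1 / ?n * \<bar>?g $ j\<bar>) * \<bar>\<Delta> $ j\<bar>)
      = (\<Sum>j\<in>UNIV. if j \<in> S then (\<nu> j + \<mu>) * \<bar>\<Delta> $ j\<bar> else - ((\<nu> j - \<mu>) * \<bar>\<Delta> $ j\<bar>))"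
    by (rule sum.cong) (auto simp: \<nu> gmc_nu_def S_def matrix_mult_dot row_def algebra_simps)
  also have "\<dots> = (\<Sum>j\<in>S. (\<nu> j + \<mu>) * \<bar>\<Delta> $ j\<bar>) - (\<Sum>j\<in>-S. (\<nu> j - \<mu>) * \<bar>\<Delta> $ j\<bar>)"
    by (simp add: sum.If_cases sum_negf Compl_eq_Diff_UNIV[symmetric])
  finally show ?thesis
    by (simp add: quad)
qed

text \<open>The quadratic form in \<open>basic\<close> is used twice: its nonnegativity puts a
  nonzero error into the cone, and there \<open>gmc_kappa\<close> bounds it below by a multiple of
  the squared norm, against a right-hand side linear in the norm.\<close>

lemma gmc_error_bound:
  fixes X :: "real^'p^'n" and B :: "real^'p^'m" and \<Delta> :: "real^'p" and \<nu> :: "'p \<Rightarrow> real"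
  assumes psd: "psd (transpose X ** X - lam *\<^sub>R (transpose B ** B))"
    and kappa: "0 < gmc_kappa X B lam S \<nu> c" (is "0 < ?\<kappa>")
    and lam: "0 < lam" and c: "1 < c"
    and S: "S \<noteq> {}" "- S \<noteq> {}" and \<nu>: "\<And>j. 0 \<le> \<nu> j"
    and basic: "\<Delta> \<bullet> ((transpose X ** X - lam *\<^sub>R (transpose B ** B)) *v \<Delta>) / (2 * real CARD('n))
      \<le> lam * ((\<Sum>j\<in>S. (\<nu> j + nu_min S \<nu> / c) * \<bar>\<Delta> $ j\<bar>)
        - (\<Sum>j\<in>-S. (\<nu> j - nu_min S \<nu> / c) * \<bar>\<Delta> $ j\<bar>))"
      (is "?q \<Delta> / (2 * ?n) \<le> lam * (?P - ?N)")
  shows "norm \<Delta> \<le> lam / ?\<kappa> * (nu_max S \<nu> + nu_min S \<nu> / c) * sqrt (real (card S))"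
proof -
  let ?M = "nu_max S \<nu> + nu_min S \<nu> / c"
  have min_le: "nu_min S \<nu> \<le> \<nu> j" if "j \<in> - S" for j
    using that by (simp add: nu_min_def)
  have max_ge: "\<nu> j \<le> nu_max S \<nu>" if "j \<in> S" for j
    using that by (simp add: nu_max_def)
  have min_nonneg: "0 \<le> nu_min S \<nu>"
    using S \<nu> by (simp add: nu_min_def)
  obtain j where "j \<in> S" using S by auto
  then have M: "0 \<le> ?M"
    using \<nu>[of j] max_ge[of j] min_nonneg c by (intro add_nonneg_nonneg) auto
  show ?thesis
  proof (cases "\<Delta> = 0")
    case True
    then show ?thesis using M lam kappa by simp
  next
    case False
    have q: "0 \<le> ?q x" for x
      using psd by (simp add: psd_def)
    have "0 \<le> lam * (?P - ?N)"
      using q[of \<Delta>] basic by (smt (verit) divide_nonneg_nonneg of_nat_0_le_iff)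
    then have "?N \<le> ?P"
      using lam by (simp add: zero_le_mult_iff)
    then have "\<Delta> \<in> gmc_cone S \<nu> c"
      using False by (simp add: gmc_cone_def)
    \<comment> \<open>An infimum over the reals lies below its members only if they are bounded
      below; semidefiniteness supplies the bound 0.\<close>
    then have "?\<kappa> \<le> ?q \<Delta> / (2 * ?n * (norm \<Delta>)\<^sup>2)"
      unfolding gmc_kappa_def
      by (rule cINF_lower[rotated]) (auto intro!: bdd_belowI[where m = 0] divide_nonneg_nonneg q)
    then have "?\<kappa> * (norm \<Delta>)\<^sup>2 \<le> ?q \<Delta> / (2 * ?n)"
      using False by (simp add: field_simps)
    also note basic
    also have "lam * (?P - ?N) \<le> lam * ?P"
    proof -
      have "nu_min S \<nu> / c \<le> \<nu> j" if "j \<in> - S" for j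
      proof -
        have "nu_min S \<nu> / c \<le> nu_min S \<nu> / 1"
          using min_nonneg c by (intro divide_left_mono) auto
        then show ?thesis using min_le[OF that] by simp
      qed
      then have "0 \<le> ?N"
        by (intro sum_nonneg mult_nonneg_nonneg) auto
      then show ?thesis using lam by (intro mult_left_mono) auto
    qed
    also have "?P \<le> (\<Sum>j\<in>S. ?M * \<bar>\<Delta> $ j\<bar>)"
      by (intro sum_mono mult_right_mono add_right_mono max_ge) auto
    also have "\<dots> = ?M * (\<Sum>j\<in>S. \<bar>\<Delta> $ j\<bar>)"
      by (simp add: sum_distrib_left)
    also have "\<dots> \<le> ?M * (sqrt (real (card S)) * norm \<Delta>)"
      by (intro mult_left_mono sum_abs_le_sqrt_card_norm M)
    finally have "?\<kappa> * norm \<Delta> * norm \<Delta> \<le> lam * ?M * sqrt (real (card S)) * norm \<Delta>"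
      using lam by (simp add: power2_eq_square mult.assoc)
    then have "?\<kappa> * norm \<Delta> \<le> lam * ?M * sqrt (real (card S))"
      using False by simp
    then show ?thesis
      using kappa by (simp add: field_simps)
  qed
qed

text \<open>The estimator is an arbitrary choice of minimisers without a measurability assumption,
  so the probability is stated for an event on which the bound holds.\<close>

theorem theorem4p2:
  fixes M :: "'a measure"
    and X :: "real^'p^'n" and B :: "real^'p^'m"
    and K \<beta> v :: "real^'p"
    and y \<epsilon> :: "'a \<Rightarrow> real^'n" and \<beta>hat :: "'a \<Rightarrow> real^'p"
    and S :: "'p set" and \<nu> :: "'p \<Rightarrow> real"
    and c k\<^sub>2 k \<sigma> lam :: real
  assumes prob: "prob_space M"
    and c: "1 < c" and k2: "0 < k\<^sub>2" "k\<^sub>2 < 1 / 2"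
    and K_nonneg: "\<And>j. 0 \<le> K $ j"
    and S: "S = {j. \<beta> $ j \<noteq> 0}" "S \<noteq> {}" "- S \<noteq> {}"
    and v: "is_arg_min (gmc_inner CARD('n) B K \<beta>) (\<lambda>_. True) v"
    and nu: "\<nu> = gmc_nu CARD('n) B K \<beta> v S"
    and columns: "\<And>j. norm (column j X) \<le> sqrt (real CARD('n))"
    and lam_eq: "lam = c * \<sigma> / nu_min S \<nu> * sqrt (2 * ln (real CARD('p) / k\<^sub>2) / real CARD('n))"
    and A1_model: "\<And>\<omega>. \<omega> \<in> space M \<Longrightarrow> y \<omega> = X *v \<beta> + \<epsilon> \<omega>"
    and A1_sigma: "0 < \<sigma>"
    and A1_indep: "prob_space.indep_vars M (\<lambda>_. borel) (\<lambda>i \<omega>. \<epsilon> \<omega> $ i) UNIV"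
    and A1_subgaussian: "\<And>i. subgaussian M \<sigma> (\<lambda>\<omega>. \<epsilon> \<omega> $ i)"
    and A2: "psd (transpose X ** X - lam *\<^sub>R (transpose B ** B))"
    and A3: "\<And>j. j \<in> - S \<Longrightarrow> 0 < \<nu> j"
    and A4: "0 < k" "k \<le> gmc_kappa X B lam S \<nu> c"
    and estimator: "\<And>\<omega>. \<omega> \<in> space M \<Longrightarrow> is_gmc_estimator X B K lam (y \<omega>) (\<beta>hat \<omega>)"
  shows "\<exists>E \<in> sets M. 1 - 2 * k\<^sub>2 \<le> measure M E \<and>
    (\<forall>\<omega>\<in>E. norm (\<beta>hat \<omega> - \<beta>)
       \<le> c * \<sigma> / gmc_kappa X B lam S \<nu> c * (nu_max S \<nu> / nu_min S \<nu> + 1 / c)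
           * sqrt (2 * real (card S) * ln (real CARD('p) / k\<^sub>2) / real CARD('n)))"
proof -
  interpret prob_space M by fact
  let ?n = "real CARD('n)" and ?p = "real CARD('p)"
  let ?\<mu> = "nu_min S \<nu> / c" and ?\<kappa> = "gmc_kappa X B lam S \<nu> c"
  define L where "L = ln (?p / k\<^sub>2)"
  have n: "0 < ?n" and p: "1 \<le> ?p"
    by (simp_all add: Suc_leI)
  have "k\<^sub>2 < ?p" using k2 p by linarith
  then have L: "0 < L" unfolding L_def using k2 by simp
  have \<nu>: "0 \<le> \<nu> j" for j
    using A3[of j] K_nonneg[of j] by (cases "j \<in> S") (auto simp: nu gmc_nu_def)
  have "nu_min S \<nu> \<in> \<nu> ` (- S)"
    using S(3) unfolding nu_min_def by (intro Min_in) auto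
  then have min_pos: "0 < nu_min S \<nu>"
    using A3 by auto
  have lam_eq': "lam = c * \<sigma> / nu_min S \<nu> * sqrt (2 * L / ?n)"
    by (simp add: lam_eq L_def)
  have lam: "0 < lam"
    using c A1_sigma min_pos L n unfolding lam_eq' by (simp add: zero_less_mult_iff)
  \<comment> \<open>The factors \<open>c\<close> and \<open>nu_min S \<nu>\<close> in
    \<open>lam\<close> are there to cancel here, leaving a noise threshold free of the
    weights.\<close>
  have lam_\<mu>: "lam * ?\<mu> = \<sigma> * sqrt (2 * L / ?n)"
    using c min_pos by (simp add: lam_eq')
  define t where "t = ?n * (lam * ?\<mu>)"
  have t: "0 < t"
    using lam min_pos c n by (simp add: t_def)
  have "t\<^sup>2 = \<sigma>\<^sup>2 * ?n * (2 * L)"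
    using L n unfolding t_def lam_\<mu> by (simp add: power_mult_distrib power2_eq_square field_simps)
  \<comment> \<open>With column radius \<open>sqrt ?n\<close> the exponent is exactly
    \<open>L\<close>, so each one-sided tail is at most \<open>k\<^sub>2 / ?p\<close> and the 2p
    tails add up to at most \<open>2 * k\<^sub>2\<close>.\<close>
  then have exponent: "t\<^sup>2 / (2 * \<sigma>\<^sup>2 * (sqrt ?n)\<^sup>2) = L"
    using A1_sigma n by (simp add: field_simps)
  have exp_L: "exp (- L) = k\<^sub>2 / ?p"
    using k2 p by (simp add: L_def exp_minus)
  define E where "E = {\<omega>\<in>space M. \<forall>j. \<bar>column j X \<bullet> \<epsilon> \<omega>\<bar> \<le> t}"
  note bound = subgaussian_columns_bound[OF A1_indep A1_subgaussian A1_sigma _ t columns]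
  have "E \<in> events"
    unfolding E_def by (rule bound(1)) (use n in simp)
  moreover have "1 - 2 * k\<^sub>2 \<le> prob E"
    using bound(2) n p unfolding exponent exp_L E_def by simp
  moreover have "norm (\<beta>hat \<omega> - \<beta>)
      \<le> c * \<sigma> / ?\<kappa> * (nu_max S \<nu> / nu_min S \<nu> + 1 / c) * sqrt (2 * real (card S) * L / ?n)"
    if "\<omega> \<in> E" for \<omega>
  proof -
    have \<omega>: "\<omega> \<in> space M" and noise: "\<And>j. \<bar>column j X \<bullet> \<epsilon> \<omega>\<bar> \<le> ?n * (lam * ?\<mu>)"
      using that by (auto simp: E_def t_def)
    have "norm (\<beta>hat \<omega> - \<beta>)
        \<le> lam / ?\<kappa> * (nu_max S \<nu> + nu_min S \<nu> / c) * sqrt (real (card S))"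
    proof (rule gmc_error_bound[OF A2 _ lam c S(2,3) \<nu>])
      show "0 < ?\<kappa>"
        using A4 by linarith
      show "(\<beta>hat \<omega> - \<beta>) \<bullet> ((transpose X ** X - lam *\<^sub>R (transpose B ** B)) *v (\<beta>hat \<omega> - \<beta>)) / (2 * ?n)
          \<le> lam * ((\<Sum>j\<in>S. (\<nu> j + ?\<mu>) * \<bar>(\<beta>hat \<omega> - \<beta>) $ j\<bar>)
            - (\<Sum>j\<in>-S. (\<nu> j - ?\<mu>) * \<bar>(\<beta>hat \<omega> - \<beta>) $ j\<bar>))"
        using gmc_basic_inequality[OF K_nonneg less_imp_le[OF lam] v
            estimator[OF \<omega>, unfolded A1_model[OF \<omega>]] nu[unfolded S(1)] noise]
        unfolding S(1)[symmetric] .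
    qed
    \<comment> \<open>The denominator \<open>nu_min S \<nu>\<close> of \<open>lam\<close> is
      absorbed into the sum of weights, which produces the ratio of \<open>nu_max S \<nu>\<close> to
      \<open>nu_min S \<nu>\<close>.\<close>
    also have "\<dots> = c * \<sigma> / ?\<kappa> * (nu_max S \<nu> / nu_min S \<nu> + 1 / c)
        * (sqrt (2 * L / ?n) * sqrt (real (card S)))"
      using min_pos c by (simp add: lam_eq' field_simps)
    also have "sqrt (2 * L / ?n) * sqrt (real (card S)) = sqrt (2 * real (card S) * L / ?n)"
      by (simp flip: real_sqrt_mult add: mult_ac)
    finally show ?thesis .
  qed
  ultimately show ?thesis
    unfolding L_def by blast
qed

end
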